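(* Let $X$ be a set, let $\rho$ be an $R_0$ topology on $X$ such that $X$ is the union of infinitely many pairwise disjoint point closures $cl_\rho(x)$, and let $\tau\in\mathcal{L}_\rho$ be $R_1$. Then $\tau$ is minimal $R_1$ in $\mathcal{L}_\rho$ if and only if every $\tau$-open filter $\mathcal{F}$ on $X$ such that $adh_\tau\mathcal{F}=cl_\tau(x)$ for some $x\in X$ is $\tau$-convergent (necessarily to every point of $cl_\tau(x)$).
   Context: Topologies on $X$ are ordered by inclusion ($\leq$ means $\subseteq$). For a topology $\tau$, $cl_\tau(A)$ is the $\tau$-closure of $A$ and $cl_\tau(x)=cl_\tau(\{x\})$ (a point closure). $\tau$ is $R_0$ if for all $x,y\in X$, $x\in cl_\tau(y)$ iff $y\in cl_\tau(x)$ (equivalently, the point closures partition $X$). $\tau$ is $R_1$ if for all $x,y\in X$ with $cl_\tau(x)\neq cl_\tau(y)$ there are disjoint $\tau$-open sets, one containing $cl_\tau(x)$ and the other containing $cl_\tau(y)$. For a topology $\rho$ on $X$, $\mathcal{L}_\rho=\{\tau : \tau \text{ a topology on } X,\ at(\rho)\leq\tau\leq\overline{\rho}\}$, where $at(\rho)$ is the topology generated by the sets $X\setminus cl_\rho(H)$ with $H\subseteq X$ finite, and $\overline{\rho}$ is the closure of $\rho$ in $2^X=\{0,1\}^X$ with the product topology (sets identified with characteristic functions); $\overline\rho$ is the smallest topology containing $\rho$ that is closed under arbitrary intersections, i.e. the family of all sets that are intersections of $\rho$-open sets. $\tau\in\mathcal{L}_\rho$ is minimal $R_1$ in $\mathcal{L}_\rho$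 if $\tau$ is $R_1$ and no member of $\mathcal{L}_\rho$ strictly contained in $\tau$ is $R_1$. A $\tau$-open filter is a (proper) filter consisting of $\tau$-open sets, i.e. a nonempty family of nonempty $\tau$-open sets closed under finite intersections and under passing to $\tau$-open supersets. $adh_\tau\mathcal{F}=\bigcap_{F\in\mathcal{F}}cl_\tau(F)$. $\mathcal{N}_\tau(x)$ is the family of $\tau$-open sets containing $x$; $\mathcal{F}$ is $\tau$-convergent to $x$ if $\mathcal{F}\supseteq\mathcal{N}_\tau(x)$, and $\tau$-convergent if it is $\tau$-convergent to some point. *)

theory Defs
  imports "HOL-Analysis.Analysis"
begin

definition topology_le :: "'a topology \<Rightarrow> 'a topology \<Rightarrow> bool"  (infix "\<le>\<^sub>T" 50) where
  "\<sigma> \<le>\<^sub>T \<tau> \<longleftrightarrow> (\<forall>U. openin \<sigma> U \<longrightarrow> openin \<tau> U)"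

definition R0_space :: "'a topology \<Rightarrow> bool" where
  "R0_space \<tau> \<longleftrightarrow>
     (\<forall>x \<in> topspace \<tau>. \<forall>y \<in> topspace \<tau>. x \<in> \<tau> closure_of {y} \<longleftrightarrow> y \<in> \<tau> closure_of {x})"

definition R1_space :: "'a topology \<Rightarrow> bool" where
  "R1_space \<tau> \<longleftrightarrow>
     (\<forall>x \<in> topspace \<tau>. \<forall>y \<in> topspace \<tau>. \<tau> closure_of {x} \<noteq> \<tau> closure_of {y} \<longrightarrow>
        (\<exists>U V. openin \<tau> U \<and> openin \<tau> V \<and> disjnt U V \<and>
               \<tau> closure_of {x} \<subseteq> U \<and> \<tau> closure_of {y} \<subseteq> V))"

definition at_topology :: "'a topology \<Rightarrow> 'a topology" where
  "at_topology \<rho> =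
     topology_generated_by {topspace \<rho> - \<rho> closure_of H | H. finite H \<and> H \<subseteq> topspace \<rho>}"

text \<open>A subset of \<open>X\<close> as a point of \<open>2\<^sup>X\<close>. Points of a product topology over \<open>X\<close> are functions
  that are \<open>undefined\<close> outside \<open>X\<close>, hence the restriction.\<close>

definition char_fun :: "'a set \<Rightarrow> 'a set \<Rightarrow> 'a \<Rightarrow> bool" where
  "char_fun X A = restrict (\<lambda>x. x \<in> A) X"

definition two_power :: "'a set \<Rightarrow> ('a \<Rightarrow> bool) topology" where
  "two_power X = product_topology (\<lambda>_. discrete_topology UNIV) X"

text \<open>The closure of \<open>\<rho>\<close> in \<open>2\<^sup>X\<close>. That this family is a topology, so that \<open>topology\<close>
  returns a meaningful value, and that it consists of the intersections of open sets is
  shown in \<open>openin_bar_topology\<close> and \<open>openin_bar_topology_Inter\<close>.\<close>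

definition bar_topology :: "'a topology \<Rightarrow> 'a topology" where
  "bar_topology \<rho> = topology (\<lambda>A. A \<subseteq> topspace \<rho> \<and>
     char_fun (topspace \<rho>) A \<in>
       two_power (topspace \<rho>) closure_of (char_fun (topspace \<rho>) ` {U. openin \<rho> U}))"

definition L_family :: "'a topology \<Rightarrow> 'a topology set" where
  "L_family \<rho> =
     {\<tau>. topspace \<tau> = topspace \<rho> \<and> at_topology \<rho> \<le>\<^sub>T \<tau> \<and> \<tau> \<le>\<^sub>T bar_topology \<rho>}"

definition minimal_R1_in :: "'a topology \<Rightarrow> 'a topology set \<Rightarrow> bool" where
  "minimal_R1_in \<tau> \<L> \<longleftrightarrow>
     \<tau> \<in> \<L> \<and> R1_space \<tau> \<and> \<not> (\<exists>\<sigma>\<in>\<L>. \<sigma> \<le>\<^sub>T \<tau> \<and> \<sigma> \<noteq> \<tau> \<and> R1_space \<sigma>)"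

definition open_filter :: "'a topology \<Rightarrow> 'a set set \<Rightarrow> bool" where
  "open_filter \<tau> \<F> \<longleftrightarrow>
     \<F> \<noteq> {} \<and> (\<forall>U\<in>\<F>. openin \<tau> U \<and> U \<noteq> {}) \<and>
     (\<forall>U\<in>\<F>. \<forall>V\<in>\<F>. U \<inter> V \<in> \<F>) \<and>
     (\<forall>U\<in>\<F>. \<forall>V. openin \<tau> V \<and> U \<subseteq> V \<longrightarrow> V \<in> \<F>)"

definition adherence :: "'a topology \<Rightarrow> 'a set set \<Rightarrow> 'a set" where
  "adherence \<tau> \<F> = (\<Inter>F\<in>\<F>. \<tau> closure_of F)"

definition open_nbhds :: "'a topology \<Rightarrow> 'a \<Rightarrow> 'a set set" where
  "open_nbhds \<tau> x = {U. openin \<tau> U \<and> x \<in> U}"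

definition converges_to :: "'a topology \<Rightarrow> 'a set set \<Rightarrow> 'a \<Rightarrow> bool" where
  "converges_to \<tau> \<F> x \<longleftrightarrow> open_nbhds \<tau> x \<subseteq> \<F>"

definition convergent_open_filter :: "'a topology \<Rightarrow> 'a set set \<Rightarrow> bool" where
  "convergent_open_filter \<tau> \<F> \<longleftrightarrow> (\<exists>x \<in> topspace \<tau>. converges_to \<tau> \<F> x)"

lemma char_fun_in_closure:
  assumes "A \<subseteq> X"
  shows "char_fun X A \<in> two_power X closure_of (char_fun X ` \<C>) \<longleftrightarrow>
         (\<forall>F. finite F \<and> F \<subseteq> X \<longrightarrow> (\<exists>V\<in>\<C>. V \<inter> F = A \<inter> F))" (is "?L \<longleftrightarrow> ?R")
proof
  assume L: ?L
  show ?R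
  proof (intro allI impI)
    fix F assume F: "finite F \<and> F \<subseteq> X"
    define W where "W = (\<Pi>\<^sub>E i\<in>X. if i \<in> F then {i \<in> A} else UNIV)"
    have "openin (two_power X) W"
      unfolding two_power_def W_def
      by (rule product_topology_basis) (auto intro: finite_subset[OF _ conjunct1[OF F]])
    moreover have "char_fun X A \<in> W"
      by (auto simp: W_def char_fun_def)
    ultimately obtain V where V: "V \<in> \<C>" "char_fun X V \<in> W"
      using L by (auto simp: in_closure_of)
    have "i \<in> V \<longleftrightarrow> i \<in> A" if "i \<in> F" for i
    proof -
      have "i \<in> X" using F that by auto
      then have "char_fun X V i \<in> (if i \<in> F then {i \<in> A} else UNIV)"
        using V(2) unfolding W_def by (rule PiE_mem[rotated])
      then show ?thesis using that \<open>i \<in> X\<close> by (simp add: char_fun_def)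
    qed
    then show "\<exists>V\<in>\<C>. V \<inter> F = A \<inter> F"
      using V(1) by blast
  qed
next
  assume R: ?R
  show ?L
    unfolding in_closure_of
  proof (intro conjI allI impI)
    show "char_fun X A \<in> topspace (two_power X)"
      by (auto simp: two_power_def char_fun_def)
    fix W assume W: "char_fun X A \<in> W \<and> openin (two_power X) W"
    then obtain U where U: "finite {i \<in> X. U i \<noteq> (UNIV::bool set)}"
        "char_fun X A \<in> Pi\<^sub>E X U" "Pi\<^sub>E X U \<subseteq> W"
      unfolding two_power_def openin_product_topology_alt by auto
    obtain V where V: "V \<in> \<C>" "V \<inter> {i \<in> X. U i \<noteq> UNIV} = A \<inter> {i \<in> X. U i \<noteq> UNIV}"
      using R[rule_format, of "{i \<in> X. U i \<noteq> UNIV}"] U(1) by (metis (no_types, lifting) mem_Collect_eq subsetI)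
    have "char_fun X V i \<in> U i" if "i \<in> X" for i
    proof (cases "U i = UNIV")
      case False
      then have "i \<in> V \<longleftrightarrow> i \<in> A" using V(2) that by blast
      then show ?thesis using PiE_mem[OF U(2) that] that by (simp add: char_fun_def)
    qed simp
    then have "char_fun X V \<in> Pi\<^sub>E X U"
      by (auto simp: char_fun_def)
    then show "\<exists>y. y \<in> char_fun X ` \<C> \<and> y \<in> W"
      using V(1) U(3) by blast
  qed
qed

lemma char_fun_in_closure_topology:
  assumes "A \<subseteq> topspace \<rho>"
  shows "char_fun (topspace \<rho>) A \<in>
           two_power (topspace \<rho>) closure_of (char_fun (topspace \<rho>) ` {U. openin \<rho> U}) \<longleftrightarrow>
         (\<forall>x\<in>A. \<forall>y\<in>topspace \<rho> - A. \<exists>V. openin \<rho> V \<and> x \<in> V \<and> y \<notin> V)" (is "_ \<longleftrightarrow> ?R")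
  unfolding char_fun_in_closure[OF assms]
proof (intro iffI ballI allI impI)
  fix x y
  assume *: "\<forall>F. finite F \<and> F \<subseteq> topspace \<rho> \<longrightarrow> (\<exists>V\<in>{U. openin \<rho> U}. V \<inter> F = A \<inter> F)"
    and x: "x \<in> A" and y: "y \<in> topspace \<rho> - A"
  from *[rule_format, of "{x,y}"] x y assms
  obtain V where "openin \<rho> V" "V \<inter> {x,y} = A \<inter> {x,y}" by auto
  then show "\<exists>V. openin \<rho> V \<and> x \<in> V \<and> y \<notin> V"
    using x y by blast
next
  fix F assume R: ?R and F: "finite F \<and> F \<subseteq> topspace \<rho>"
  obtain V where V: "\<And>x y. x \<in> A \<Longrightarrow> y \<in> topspace \<rho> - A \<Longrightarrow> openin \<rho> (V x y) \<and> x \<in> V x y \<and> y \<notin> V x y"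
    using R by metis
  define W where "W = (\<Union>x\<in>A \<inter> F. topspace \<rho> \<inter> (\<Inter>y\<in>F - A. V x y))"
  have "openin \<rho> (topspace \<rho> \<inter> (\<Inter>y\<in>F - A. V x y))" if "x \<in> A" for x
    using openin_INT[of "F - A" \<rho> "V x"] V F that by (auto simp: Int_commute)
  then have "openin \<rho> W"
    unfolding W_def by (intro openin_Union) auto
  moreover have "W \<inter> F = A \<inter> F"
    unfolding W_def using V F assms by blast
  ultimately show "\<exists>V\<in>{U. openin \<rho> U}. V \<inter> F = A \<inter> F" by blast
qed

lemma openin_bar_topology_iff:
  "openin (bar_topology \<rho>) A \<longleftrightarrow>
     A \<subseteq> topspace \<rho> \<and> (\<forall>x\<in>A. \<forall>y\<in>topspace \<rho> - A. \<exists>V. openin \<rho> V \<and> x \<in> V \<and> y \<notin> V)"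
proof -
  have eq: "bar_topology \<rho> = topology (\<lambda>A. A \<subseteq> topspace \<rho> \<and>
       (\<forall>x\<in>A. \<forall>y\<in>topspace \<rho> - A. \<exists>V. openin \<rho> V \<and> x \<in> V \<and> y \<notin> V))" (is "_ = topology ?P")
    unfolding bar_topology_def
    by (intro arg_cong[where f = topology] ext) (meson char_fun_in_closure_topology)
  have "istopology ?P"
    unfolding istopology_def
  proof (intro conjI allI impI)
    fix S T assume S: "?P S" and T: "?P T"
    show "S \<inter> T \<subseteq> topspace \<rho>" using S by blast
    show "\<forall>x\<in>S \<inter> T. \<forall>y\<in>topspace \<rho> - S \<inter> T. \<exists>V. openin \<rho> V \<and> x \<in> V \<and> y \<notin> V"
      using S T by (metis Diff_iff Int_iff)
  next
    fix \<K> assume K: "\<forall>K\<in>\<K>. ?P K"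
    show "\<Union>\<K> \<subseteq> topspace \<rho>" using K by blast
    show "\<forall>x\<in>\<Union>\<K>. \<forall>y\<in>topspace \<rho> - \<Union>\<K>. \<exists>V. openin \<rho> V \<and> x \<in> V \<and> y \<notin> V"
      using K by (metis Diff_iff Union_iff)
  qed
  then show ?thesis
    by (simp add: eq topology_inverse')
qed

lemma openin_bar_topology:
  "openin (bar_topology \<rho>) A \<longleftrightarrow> A \<subseteq> topspace \<rho> \<and>
     char_fun (topspace \<rho>) A \<in>
       two_power (topspace \<rho>) closure_of (char_fun (topspace \<rho>) ` {U. openin \<rho> U})"
  using char_fun_in_closure_topology openin_bar_topology_iff by metis

lemma openin_bar_topology_Inter:
  "openin (bar_topology \<rho>) A \<longleftrightarrow>
     (\<exists>\<U>. (\<forall>U\<in>\<U>. openin \<rho> U) \<and> A = topspace \<rho> \<inter> \<Inter>\<U>)"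
proof
  assume A: "openin (bar_topology \<rho>) A"
  then have sub: "A \<subseteq> topspace \<rho>" by (simp add: openin_bar_topology_iff)
  have "\<exists>U. openin \<rho> U \<and> A \<subseteq> U \<and> y \<notin> U" if "y \<in> topspace \<rho> - A" for y
  proof -
    have "openin \<rho> (\<Union>{V. openin \<rho> V \<and> y \<notin> V})" by (rule openin_Union) auto
    moreover have "A \<subseteq> \<Union>{V. openin \<rho> V \<and> y \<notin> V}"
    proof
      fix x assume "x \<in> A"
      with A that obtain V where "openin \<rho> V" "x \<in> V" "y \<notin> V"
        by (metis openin_bar_topology_iff)
      then show "x \<in> \<Union>{V. openin \<rho> V \<and> y \<notin> V}" by auto
    qed
    ultimately show ?thesis by blast
  qed
  then have "topspace \<rho> \<inter> \<Inter>{U. openin \<rho> U \<and> A \<subseteq> U} = A"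
    using sub by blast
  then show "\<exists>\<U>. (\<forall>U\<in>\<U>. openin \<rho> U) \<and> A = topspace \<rho> \<inter> \<Inter>\<U>"
    by (intro exI[of _ "{U. openin \<rho> U \<and> A \<subseteq> U}"]) simp
next
  assume "\<exists>\<U>. (\<forall>U\<in>\<U>. openin \<rho> U) \<and> A = topspace \<rho> \<inter> \<Inter>\<U>"
  then obtain \<U> where U: "\<forall>U\<in>\<U>. openin \<rho> U" and A: "A = topspace \<rho> \<inter> \<Inter>\<U>"
    by (elim exE conjE)
  have "\<exists>V. openin \<rho> V \<and> x \<in> V \<and> y \<notin> V" if x: "x \<in> A" and y: "y \<in> topspace \<rho> - A" for x y
  proof -
    obtain V where "V \<in> \<U>" "y \<notin> V" using y A by auto
    then show ?thesis using U A x by auto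
  qed
  moreover have "A \<subseteq> topspace \<rho>" using A by auto
  ultimately show "openin (bar_topology \<rho>) A"
    unfolding openin_bar_topology_iff by (intro conjI ballI)
qed

end

theory Submission
  imports Defs
begin

text \<open>All members of \<open>L_family \<rho>\<close> have the same point closures as \<open>\<rho>\<close>
  (\<open>L_family_point_closure\<close>). Inside this family, \<open>R1\<close> topologies therefore separate the same
  blocks, and what distinguishes them is only how large the neighbourhoods of each block are.

  If \<open>\<sigma>\<close> is an \<open>R1\<close> member below \<open>\<tau>\<close>, then the \<open>\<sigma>\<close>-neighbourhoods of a point \<open>x\<close> generate a
  \<open>\<tau>\<close>-open filter whose \<open>\<tau>\<close>-adherence is squeezed between the two equal closures of \<open>x\<close> in
  \<open>\<tau>\<close> and \<open>\<sigma>\<close> (\<open>adherence_coarser_nbhds\<close>). If filters with such an adherence converge, each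
  \<open>\<tau>\<close>-neighbourhood of \<open>x\<close> contains a \<open>\<sigma>\<close>-neighbourhood, so \<open>\<sigma> = \<tau>\<close>.

  Conversely, let \<open>\<F>\<close> be a \<open>\<tau>\<close>-open filter with adherence \<open>cl(x)\<close> that does not converge.
  Keep the \<open>\<tau>\<close>-neighbourhoods of every point outside \<open>cl(x)\<close>, but admit as neighbourhoods of \<open>x\<close>
  only those that belong to \<open>\<F>\<close> (\<open>restrict_nbhds\<close>). A point outside \<open>cl(x)\<close> does not adhere to
  \<open>\<F>\<close>, hence has a neighbourhood missing some \<open>F \<in> \<F>\<close>; enlarging neighbourhoods of \<open>x\<close> by such
  an \<open>F\<close> puts them in \<open>\<F>\<close> and keeps them disjoint from that neighbourhood. So the new topology is
  still \<open>R1\<close> and still in \<open>L_family \<rho>\<close>, and it is strictly coarser because some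
  \<open>\<tau>\<close>-neighbourhood of \<open>x\<close> is not in \<open>\<F>\<close>.\<close>

section \<open>Point closures in R1 topologies\<close>

lemma R1_space_separate:
  assumes "R1_space \<tau>" "x \<in> topspace \<tau>" "y \<in> topspace \<tau>" "y \<notin> \<tau> closure_of {x}"
  obtains U V where "openin \<tau> U" "openin \<tau> V" "disjnt U V"
    "\<tau> closure_of {x} \<subseteq> U" "\<tau> closure_of {y} \<subseteq> V"
proof -
  have "y \<in> \<tau> closure_of {y}"
    using assms(3) by (simp add: in_closure_of)
  then show ?thesis
    using assms that unfolding R1_space_def by metis
qed

lemma R1_space_imp_R0_space:
  assumes "R1_space \<tau>"
  shows "R0_space \<tau>"
proof -
  have "x \<in> \<tau> closure_of {y}"
    if xy: "x \<in> topspace \<tau>" "y \<in> topspace \<tau>" "y \<in> \<tau> closure_of {x}" for x y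
  proof (rule ccontr)
    assume "x \<notin> \<tau> closure_of {y}"
    then obtain U V where "openin \<tau> U" "openin \<tau> V" "disjnt U V"
        "\<tau> closure_of {y} \<subseteq> U" "\<tau> closure_of {x} \<subseteq> V"
      using R1_space_separate[OF assms xy(2,1)] by metis
    moreover have "y \<in> \<tau> closure_of {y}"
      using xy(2) by (simp add: in_closure_of)
    ultimately show False
      using xy(3) by (auto simp: disjnt_iff)
  qed
  then show ?thesis
    unfolding R0_space_def by blast
qed

lemma R0_space_point_closure_subset:
  assumes "R0_space \<tau>" "openin \<tau> U" "x \<in> U"
  shows "\<tau> closure_of {x} \<subseteq> U"
proof
  fix y assume y: "y \<in> \<tau> closure_of {x}"
  then have "y \<in> topspace \<tau>" "x \<in> topspace \<tau>"
    using assms openin_subset by (auto simp: in_closure_of)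
  then have "x \<in> \<tau> closure_of {y}"
    using assms(1) y by (simp add: R0_space_def)
  then show "y \<in> U"
    using assms by (auto simp: in_closure_of)
qed

section \<open>Members of the family share their point closures\<close>

lemma topology_leD: "\<sigma> \<le>\<^sub>T \<tau> \<Longrightarrow> openin \<sigma> U \<Longrightarrow> openin \<tau> U"
  by (simp add: topology_le_def)

text \<open>The finite sets \<open>H\<close> in the subbase of \<open>at_topology \<rho>\<close> reduce to singletons, because a finite
  union of closed sets is closed.\<close>

lemma at_topology_le_iff:
  assumes top: "topspace \<sigma> = topspace \<rho>"
  shows "at_topology \<rho> \<le>\<^sub>T \<sigma> \<longleftrightarrow> (\<forall>x\<in>topspace \<rho>. closedin \<sigma> (\<rho> closure_of {x}))"
proof
  assume le: "at_topology \<rho> \<le>\<^sub>T \<sigma>"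
  show "\<forall>x\<in>topspace \<rho>. closedin \<sigma> (\<rho> closure_of {x})"
  proof
    fix x assume "x \<in> topspace \<rho>"
    then have "openin (at_topology \<rho>) (topspace \<rho> - \<rho> closure_of {x})"
      unfolding at_topology_def by (intro topology_generated_by_Basis) blast
    then show "closedin \<sigma> (\<rho> closure_of {x})"
      using le top by (simp add: closedin_def topology_leD closure_of_subset_topspace)
  qed
next
  assume cl: "\<forall>x\<in>topspace \<rho>. closedin \<sigma> (\<rho> closure_of {x})"
  have "closedin \<sigma> (\<rho> closure_of H)" if "finite H" "H \<subseteq> topspace \<rho>" for H
    using that
  proof (induction H)
    case (insert h H)
    have "\<rho> closure_of insert h H = \<rho> closure_of {h} \<union> \<rho> closure_of H"
      by (metis closure_of_Un insert_is_Un)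
    then show ?case
      using insert cl by (simp add: closedin_Un)
  qed simp
  then have basis: "openin \<sigma> (topspace \<rho> - \<rho> closure_of H)"
    if "finite H" "H \<subseteq> topspace \<rho>" for H
    using that top by (metis closedin_def)
  show "at_topology \<rho> \<le>\<^sub>T \<sigma>"
    unfolding topology_le_def at_topology_def openin_topology_generated_by_iff
  proof (intro allI impI)
    fix U
    assume "generate_topology_on {topspace \<rho> - \<rho> closure_of H |H. finite H \<and> H \<subseteq> topspace \<rho>} U"
    then show "openin \<sigma> U"
      by induction (use basis in auto)
  qed
qed

text \<open>The lower bound \<open>at_topology \<rho>\<close> makes the \<open>\<rho>\<close>-closure of a point closed in
  \<open>\<tau>\<close>. The upper bound adds only intersections of \<open>\<rho>\<close>-open sets, and these separate no
  further points.\<close>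

lemma L_family_point_closure:
  assumes "\<tau> \<in> L_family \<rho>" "x \<in> topspace \<rho>"
  shows "\<tau> closure_of {x} = \<rho> closure_of {x}"
proof
  have top: "topspace \<tau> = topspace \<rho>" and at: "at_topology \<rho> \<le>\<^sub>T \<tau>"
    and bar: "\<tau> \<le>\<^sub>T bar_topology \<rho>"
    using assms(1) by (auto simp: L_family_def)
  have "x \<in> \<rho> closure_of {x}"
    using assms(2) by (simp add: in_closure_of)
  moreover have "closedin \<tau> (\<rho> closure_of {x})"
    using at at_topology_le_iff[OF top] assms(2) by blast
  ultimately show "\<tau> closure_of {x} \<subseteq> \<rho> closure_of {x}"
    by (intro closure_of_minimal) auto
  show "\<rho> closure_of {x} \<subseteq> \<tau> closure_of {x}"
  proof
    fix y assume y: "y \<in> \<rho> closure_of {x}"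
    have "x \<in> T" if T: "openin \<tau> T" "y \<in> T" for T
    proof (rule ccontr)
      assume "x \<notin> T"
      moreover have "openin (bar_topology \<rho>) T"
        using bar T(1) by (rule topology_leD)
      ultimately obtain V where "openin \<rho> V" "y \<in> V" "x \<notin> V"
        using assms(2) T(2) unfolding openin_bar_topology_iff by blast
      then show False
        using y by (auto simp: in_closure_of)
    qed
    then show "y \<in> \<tau> closure_of {x}"
      using y top by (auto simp: in_closure_of)
  qed
qed

section \<open>Open filters\<close>

lemma
  assumes "open_filter \<tau> \<F>"
  shows open_filter_openin: "U \<in> \<F> \<Longrightarrow> openin \<tau> U"
    and open_filter_Int: "U \<in> \<F> \<Longrightarrow> V \<in> \<F> \<Longrightarrow> U \<inter> V \<in> \<F>"
    and open_filter_mono: "U \<in> \<F> \<Longrightarrow> openin \<tau> V \<Longrightarrow> U \<subseteq> V \<Longrightarrow> V \<in> \<F>"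
    and open_filter_nonempty: "U \<in> \<F> \<Longrightarrow> U \<noteq> {}"
  using assms unfolding open_filter_def by blast+

lemma adherenceD: "y \<in> adherence \<tau> \<F> \<Longrightarrow> F \<in> \<F> \<Longrightarrow> y \<in> \<tau> closure_of F"
  by (simp add: adherence_def)

lemma not_in_adherenceE:
  assumes "y \<notin> adherence \<tau> \<F>"
  obtains F where "F \<in> \<F>" "y \<notin> \<tau> closure_of F"
  using assms by (auto simp: adherence_def)

lemma converges_to_imp_adherence:
  assumes "open_filter \<tau> \<F>" "converges_to \<tau> \<F> z" "z \<in> topspace \<tau>"
  shows "z \<in> adherence \<tau> \<F>"
  unfolding adherence_def
proof
  fix F assume F: "F \<in> \<F>"
  have "\<exists>y. y \<in> F \<and> y \<in> T" if "z \<in> T" "openin \<tau> T" for T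
  proof -
    have "T \<in> \<F>"
      using assms(2) that by (auto simp: converges_to_def open_nbhds_def)
    then have "F \<inter> T \<noteq> {}"
      using F assms(1) by (intro open_filter_nonempty open_filter_Int)
    then show ?thesis by blast
  qed
  then show "z \<in> \<tau> closure_of F"
    using assms(3) by (auto simp: in_closure_of)
qed

text \<open>A limit lies in the adherence, hence in \<open>cl(x)\<close>; and points of one block of an \<open>R0\<close>
  topology have the same neighbourhoods.\<close>

lemma convergent_imp_converges_to_point_closure:
  assumes "R0_space \<tau>" "open_filter \<tau> \<F>" "convergent_open_filter \<tau> \<F>"
    and adh: "adherence \<tau> \<F> = \<tau> closure_of {x}" and y: "y \<in> \<tau> closure_of {x}"
  shows "converges_to \<tau> \<F> y"
proof -
  obtain z where z: "z \<in> topspace \<tau>" "converges_to \<tau> \<F> z"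
    using assms(3) by (auto simp: convergent_open_filter_def)
  then have zx: "z \<in> \<tau> closure_of {x}"
    using converges_to_imp_adherence[OF assms(2)] adh by simp
  have "z \<in> U" if "openin \<tau> U" "y \<in> U" for U
  proof -
    have "x \<in> U"
      using y that by (auto simp: in_closure_of)
    then show ?thesis
      using R0_space_point_closure_subset[OF assms(1) that(1)] zx by blast
  qed
  then show ?thesis
    using z(2) by (auto simp: converges_to_def open_nbhds_def)
qed

section \<open>Coarser R1 topologies yield filters\<close>

lemma open_filter_coarser_nbhds:
  assumes "\<sigma> \<le>\<^sub>T \<tau>" "x \<in> topspace \<sigma>"
  shows "open_filter \<tau> {W. openin \<tau> W \<and> (\<exists>N\<in>open_nbhds \<sigma> x. N \<subseteq> W)}" (is "open_filter \<tau> ?\<F>")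
proof -
  have "topspace \<sigma> \<in> ?\<F>"
    using assms by (auto simp: open_nbhds_def topology_le_def)
  then have "?\<F> \<noteq> {}"
    by force
  moreover have "U \<inter> V \<in> ?\<F>" if UV: "U \<in> ?\<F>" "V \<in> ?\<F>" for U V
  proof -
    obtain M N where "M \<in> open_nbhds \<sigma> x" "M \<subseteq> U" "N \<in> open_nbhds \<sigma> x" "N \<subseteq> V"
      using UV by blast
    then have "M \<inter> N \<in> open_nbhds \<sigma> x" "M \<inter> N \<subseteq> U \<inter> V"
      by (auto simp: open_nbhds_def)
    then show ?thesis
      using UV by blast
  qed
  moreover have "V \<in> ?\<F>" if "U \<in> ?\<F>" "openin \<tau> V" "U \<subseteq> V" for U V
    using that by blast
  moreover have "openin \<tau> U \<and> U \<noteq> {}" if "U \<in> ?\<F>" for U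
    using that by (auto simp: open_nbhds_def)
  ultimately show ?thesis
    unfolding open_filter_def by (intro conjI ballI allI impI) iprover+
qed

text \<open>\<open>\<tau>\<close>-closures are contained in \<open>\<sigma>\<close>-closures, and in an \<open>R1\<close> topology the closed
  neighbourhoods of \<open>x\<close> intersect in \<open>cl(x)\<close>.\<close>

lemma adherence_coarser_nbhds:
  assumes le: "\<sigma> \<le>\<^sub>T \<tau>" and top: "topspace \<sigma> = topspace \<tau>" and x: "x \<in> topspace \<sigma>"
    and R1: "R1_space \<sigma>" and cl: "\<sigma> closure_of {x} = \<tau> closure_of {x}"
  shows "adherence \<tau> {W. openin \<tau> W \<and> (\<exists>N\<in>open_nbhds \<sigma> x. N \<subseteq> W)} = \<tau> closure_of {x}"
    (is "adherence \<tau> ?\<F> = _")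
proof
  show "\<tau> closure_of {x} \<subseteq> adherence \<tau> ?\<F>"
    unfolding adherence_def
    by (intro INT_greatest closure_of_mono) (auto simp: open_nbhds_def)
  show "adherence \<tau> ?\<F> \<subseteq> \<tau> closure_of {x}"
  proof (rule subsetI, rule ccontr)
    fix y assume y: "y \<in> adherence \<tau> ?\<F>" and "y \<notin> \<tau> closure_of {x}"
    have "topspace \<sigma> \<in> ?\<F>"
      using le x by (auto simp: open_nbhds_def topology_le_def)
    with y have "y \<in> \<tau> closure_of topspace \<sigma>"
      by (rule adherenceD)
    then have ytop: "y \<in> topspace \<sigma>"
      using top by (simp add: in_closure_of)
    obtain U V where UV: "openin \<sigma> U" "openin \<sigma> V" "disjnt U V"
        "\<sigma> closure_of {x} \<subseteq> U" "\<sigma> closure_of {y} \<subseteq> V"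
      using R1_space_separate[OF R1 x ytop] \<open>y \<notin> \<tau> closure_of {x}\<close> cl by metis
    have xU: "x \<in> U" and yV: "y \<in> V"
      using UV x ytop by (auto simp: in_closure_of)
    have "U \<in> ?\<F>"
      using xU UV(1) le by (auto simp: open_nbhds_def topology_leD)
    with y have "y \<in> \<tau> closure_of U"
      by (rule adherenceD)
    moreover have "openin \<tau> V"
      using le UV(2) by (rule topology_leD)
    ultimately show False
      using UV(3) yV by (auto simp: in_closure_of disjnt_iff)
  qed
qed

section \<open>Coarsening a topology along a filter\<close>

definition restrict_nbhds :: "'a topology \<Rightarrow> 'a \<Rightarrow> 'a set set \<Rightarrow> 'a topology" where
  "restrict_nbhds \<tau> x \<F> = topology (\<lambda>U. openin \<tau> U \<and> (x \<in> U \<longrightarrow> U \<in> \<F>))"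

lemma openin_restrict_nbhds:
  assumes "open_filter \<tau> \<F>"
  shows "openin (restrict_nbhds \<tau> x \<F>) U \<longleftrightarrow> openin \<tau> U \<and> (x \<in> U \<longrightarrow> U \<in> \<F>)"
proof -
  let ?P = "\<lambda>U. openin \<tau> U \<and> (x \<in> U \<longrightarrow> U \<in> \<F>)"
  have "?P (\<Union>\<K>)" if "\<forall>K\<in>\<K>. ?P K" for \<K>
  proof -
    have op: "openin \<tau> (\<Union>\<K>)"
      using that by blast
    moreover have "\<Union>\<K> \<in> \<F>" if "x \<in> \<Union>\<K>"
    proof -
      from that obtain K where "K \<in> \<K>" "x \<in> K" by blast
      then show ?thesis
        using \<open>\<forall>K\<in>\<K>. ?P K\<close> open_filter_mono[OF assms _ op] by blast
    qed
    ultimately show ?thesis by blast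
  qed
  moreover have "?P (S \<inter> T)" if "?P S" "?P T" for S T
    using that open_filter_Int[OF assms] by blast
  ultimately have "istopology ?P"
    unfolding istopology_def by blast
  then show ?thesis
    by (simp add: restrict_nbhds_def topology_inverse')
qed

lemma restrict_nbhds_le: "open_filter \<tau> \<F> \<Longrightarrow> restrict_nbhds \<tau> x \<F> \<le>\<^sub>T \<tau>"
  by (simp add: topology_le_def openin_restrict_nbhds)

lemma topspace_restrict_nbhds:
  assumes "open_filter \<tau> \<F>"
  shows "topspace (restrict_nbhds \<tau> x \<F>) = topspace \<tau>"
proof
  obtain F where "F \<in> \<F>"
    using assms by (auto simp: open_filter_def)
  then have "topspace \<tau> \<in> \<F>"
    using assms open_filter_mono open_filter_openin openin_subset openin_topspace by metis
  then show "topspace \<tau> \<subseteq> topspace (restrict_nbhds \<tau> x \<F>)"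
    using assms by (intro openin_subset) (simp add: openin_restrict_nbhds)
  show "topspace (restrict_nbhds \<tau> x \<F>) \<subseteq> topspace \<tau>"
    using assms by (metis openin_restrict_nbhds openin_subset openin_topspace)
qed

text \<open>The complement of \<open>cl(y)\<close> is unproblematic if it omits \<open>x\<close>. Otherwise \<open>y\<close> does not adhere
  to \<open>\<F>\<close>, so some \<open>F \<in> \<F>\<close> misses a neighbourhood of \<open>y\<close>, which contains \<open>cl(y)\<close>; thus the
  complement of \<open>cl(y)\<close> contains \<open>F\<close> and is itself in \<open>\<F>\<close>.\<close>

lemma closedin_restrict_nbhds_point_closure:
  assumes R0: "R0_space \<tau>" and \<F>: "open_filter \<tau> \<F>"
    and adh: "adherence \<tau> \<F> = \<tau> closure_of {x}" and y: "y \<in> topspace \<tau>"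
  shows "closedin (restrict_nbhds \<tau> x \<F>) (\<tau> closure_of {y})"
proof -
  have "topspace \<tau> - \<tau> closure_of {y} \<in> \<F>" if x: "x \<in> topspace \<tau> - \<tau> closure_of {y}"
  proof -
    have "y \<notin> adherence \<tau> \<F>"
      using x y R0 by (auto simp: adh R0_space_def)
    then obtain F where F: "F \<in> \<F>" "y \<notin> \<tau> closure_of F"
      by (rule not_in_adherenceE)
    have Fsub: "F \<subseteq> topspace \<tau>"
      using open_filter_openin[OF \<F> F(1)] by (rule openin_subset)
    have "\<tau> closure_of {y} \<subseteq> topspace \<tau> - \<tau> closure_of F"
      using y F(2) by (intro R0_space_point_closure_subset[OF R0]) (auto simp: openin_diff)
    then have "F \<subseteq> topspace \<tau> - \<tau> closure_of {y}"
      using Fsub closure_of_subset[OF Fsub] by blast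
    then show ?thesis
      using open_filter_mono[OF \<F> F(1)] by (simp add: openin_diff)
  qed
  moreover have "openin \<tau> (topspace \<tau> - \<tau> closure_of {y})"
    by (simp add: openin_diff)
  ultimately show ?thesis
    using \<F> by (simp add: closedin_def topspace_restrict_nbhds openin_restrict_nbhds
        closure_of_subset_topspace)
qed

lemma restrict_nbhds_in_L_family:
  assumes "\<tau> \<in> L_family \<rho>" "R0_space \<tau>" "open_filter \<tau> \<F>" "adherence \<tau> \<F> = \<tau> closure_of {x}"
  shows "restrict_nbhds \<tau> x \<F> \<in> L_family \<rho>"
proof -
  let ?\<sigma> = "restrict_nbhds \<tau> x \<F>"
  have top: "topspace \<tau> = topspace \<rho>" and bar: "\<tau> \<le>\<^sub>T bar_topology \<rho>"
    using assms(1) by (auto simp: L_family_def)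
  have top\<sigma>: "topspace ?\<sigma> = topspace \<rho>"
    using topspace_restrict_nbhds[OF assms(3)] top by simp
  have "closedin ?\<sigma> (\<rho> closure_of {y})" if "y \<in> topspace \<rho>" for y
    using closedin_restrict_nbhds_point_closure[OF assms(2-4)] that top
    by (simp flip: L_family_point_closure[OF assms(1) that])
  then have "at_topology \<rho> \<le>\<^sub>T ?\<sigma>"
    by (simp add: at_topology_le_iff[OF top\<sigma>])
  moreover have "?\<sigma> \<le>\<^sub>T bar_topology \<rho>"
    using restrict_nbhds_le[OF assms(3)] bar by (auto simp: topology_le_def)
  ultimately show ?thesis
    using top\<sigma> by (simp add: L_family_def)
qed

text \<open>It suffices to separate \<open>y\<close> from \<open>z\<close> when \<open>z \<notin> cl(x)\<close>, since two distinct blocks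
  cannot both be \<open>cl(x)\<close>.\<close>

lemma R1_space_restrict_nbhds:
  assumes R1: "R1_space \<tau>" and \<F>: "open_filter \<tau> \<F>" and x: "x \<in> topspace \<tau>"
    and adh: "adherence \<tau> \<F> = \<tau> closure_of {x}"
    and cl: "\<And>y. y \<in> topspace \<tau> \<Longrightarrow> restrict_nbhds \<tau> x \<F> closure_of {y} = \<tau> closure_of {y}"
  shows "R1_space (restrict_nbhds \<tau> x \<F>)"
proof -
  let ?\<sigma> = "restrict_nbhds \<tau> x \<F>"
  have R0: "R0_space \<tau>"
    using R1 by (rule R1_space_imp_R0_space)
  have sep: "\<exists>U V. openin ?\<sigma> U \<and> openin ?\<sigma> V \<and> disjnt U V \<and>
               \<tau> closure_of {y} \<subseteq> U \<and> \<tau> closure_of {z} \<subseteq> V"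
    if y: "y \<in> topspace \<tau>" and z: "z \<in> topspace \<tau>"
      and yz: "\<tau> closure_of {y} \<noteq> \<tau> closure_of {z}" and zx: "z \<notin> \<tau> closure_of {x}" for y z
  proof -
    obtain U V where UV: "openin \<tau> U" "openin \<tau> V" "disjnt U V"
        "\<tau> closure_of {y} \<subseteq> U" "\<tau> closure_of {z} \<subseteq> V"
      using R1 y z yz unfolding R1_space_def by metis
    have zV: "z \<in> V" and yU: "y \<in> U"
      using UV y z by (auto simp: in_closure_of)
    obtain F where F: "F \<in> \<F>" "z \<notin> \<tau> closure_of F"
      using zx adh not_in_adherenceE by metis
    have Fop: "openin \<tau> F"
      using \<F> F(1) by (rule open_filter_openin)
    \<comment> \<open>Adding \<open>F\<close> puts a neighbourhood of \<open>y\<close> into \<open>\<F>\<close> whether or not it contains \<open>x\<close>;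
      removing \<open>cl(F)\<close> restores disjointness, and since \<open>x \<in> cl(F)\<close> it also spares the
      neighbourhood of \<open>z\<close> any condition at \<open>x\<close>.\<close>
    define U' V' where "U' = U \<union> F" and "V' = V - \<tau> closure_of F"
    have "U' \<in> \<F>"
      using open_filter_mono[OF \<F> F(1)] UV(1) Fop by (auto simp: U'_def)
    then have "openin ?\<sigma> U'"
      using \<F> open_filter_openin[OF \<F>] by (simp add: openin_restrict_nbhds)
    moreover have V'op: "openin \<tau> V'"
      using UV(2) by (simp add: V'_def openin_diff)
    moreover have "x \<in> \<tau> closure_of F"
      using x F(1) adh by (intro adherenceD[of x \<tau> \<F>]) (auto simp: in_closure_of)
    ultimately have "openin ?\<sigma> U'" "openin ?\<sigma> V'"
      using \<F> by (auto simp: openin_restrict_nbhds V'_def)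
    moreover have "disjnt U' V'"
      using UV(3) closure_of_subset[OF openin_subset[OF Fop]]
      by (auto simp: U'_def V'_def disjnt_iff)
    moreover have "\<tau> closure_of {z} \<subseteq> V'"
      using V'op zV F(2) by (intro R0_space_point_closure_subset[OF R0]) (auto simp: V'_def)
    moreover have "\<tau> closure_of {y} \<subseteq> U'"
      using UV(4) by (auto simp: U'_def)
    ultimately show ?thesis by blast
  qed
  have block: "\<tau> closure_of {z} = \<tau> closure_of {x}" if z: "z \<in> \<tau> closure_of {x}" for z
  proof
    show "\<tau> closure_of {z} \<subseteq> \<tau> closure_of {x}"
      using z by (intro closure_of_minimal) auto
    have "x \<in> \<tau> closure_of {z}"
      using R0 x z by (metis R0_space_def in_closure_of)
    then show "\<tau> closure_of {x} \<subseteq> \<tau> closure_of {z}"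
      by (intro closure_of_minimal) auto
  qed
  have "\<exists>U V. openin ?\<sigma> U \<and> openin ?\<sigma> V \<and> disjnt U V \<and>
               \<tau> closure_of {y} \<subseteq> U \<and> \<tau> closure_of {z} \<subseteq> V"
    if y: "y \<in> topspace \<tau>" and z: "z \<in> topspace \<tau>"
      and yz: "\<tau> closure_of {y} \<noteq> \<tau> closure_of {z}" for y z
  proof (cases "z \<in> \<tau> closure_of {x}")
    case True
    then have "y \<notin> \<tau> closure_of {x}"
      using yz block by metis
    from sep[OF z y yz[symmetric] this] show ?thesis
      by (metis disjnt_sym)
  next
    case False
    then show ?thesis
      using sep y z yz by blast
  qed
  then show ?thesis
    unfolding R1_space_def by (simp add: topspace_restrict_nbhds[OF \<F>] cl)
qed

section \<open>Minimality and convergence of filters\<close>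

lemma filters_converge_imp_minimal_R1:
  assumes \<tau>: "\<tau> \<in> L_family \<rho>" and R1: "R1_space \<tau>"
    and conv: "\<And>\<F> x. open_filter \<tau> \<F> \<Longrightarrow> x \<in> topspace \<tau> \<Longrightarrow>
      adherence \<tau> \<F> = \<tau> closure_of {x} \<Longrightarrow> convergent_open_filter \<tau> \<F>"
  shows "minimal_R1_in \<tau> (L_family \<rho>)"
proof -
  have coarsest: "\<sigma> = \<tau>" if \<sigma>: "\<sigma> \<in> L_family \<rho>" and le: "\<sigma> \<le>\<^sub>T \<tau>" and R1\<sigma>: "R1_space \<sigma>" for \<sigma>
  proof -
    have top: "topspace \<sigma> = topspace \<tau>" "topspace \<sigma> = topspace \<rho>"
      using \<sigma> \<tau> by (auto simp: L_family_def)
    have "openin \<sigma> U" if U: "openin \<tau> U" for U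
    proof (subst openin_subopen, intro ballI)
      fix x assume xU: "x \<in> U"
      let ?\<F> = "{W. openin \<tau> W \<and> (\<exists>N\<in>open_nbhds \<sigma> x. N \<subseteq> W)}"
      have x: "x \<in> topspace \<sigma>"
        using xU openin_subset[OF U] top by auto
      have cl: "\<sigma> closure_of {x} = \<tau> closure_of {x}"
        using x top L_family_point_closure[OF \<sigma>] L_family_point_closure[OF \<tau>] by simp
      have \<F>: "open_filter \<tau> ?\<F>"
        using le x by (rule open_filter_coarser_nbhds)
      have adh: "adherence \<tau> ?\<F> = \<tau> closure_of {x}"
        using le top(1) x R1\<sigma> cl by (rule adherence_coarser_nbhds)
      have "convergent_open_filter \<tau> ?\<F>"
        using x unfolding top(1) by (rule conv[OF \<F> _ adh])
      then have "converges_to \<tau> ?\<F> x"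
      proof (rule convergent_imp_converges_to_point_closure[OF R1_space_imp_R0_space[OF R1] \<F> _ adh])
        show "x \<in> \<tau> closure_of {x}"
          using x top(1) by (simp add: in_closure_of)
      qed
      then have "open_nbhds \<tau> x \<subseteq> ?\<F>"
        by (simp only: converges_to_def)
      moreover have "U \<in> open_nbhds \<tau> x"
        using U xU by (simp add: open_nbhds_def)
      ultimately have "U \<in> ?\<F>"
        by (rule subsetD)
      then show "\<exists>T. openin \<sigma> T \<and> x \<in> T \<and> T \<subseteq> U"
        by (auto simp: open_nbhds_def)
    qed
    then show ?thesis
      using le unfolding topology_eq topology_le_def by blast
  qed
  show ?thesis
    unfolding minimal_R1_in_def
  proof (intro conjI \<tau> R1 notI)
    assume "\<exists>\<sigma>\<in>L_family \<rho>. \<sigma> \<le>\<^sub>T \<tau> \<and> \<sigma> \<noteq> \<tau> \<and> R1_space \<sigma>"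
    then obtain \<sigma> where "\<sigma> \<in> L_family \<rho>" "\<sigma> \<le>\<^sub>T \<tau>" "\<sigma> \<noteq> \<tau>" "R1_space \<sigma>"
      by (elim bexE conjE)
    then show False
      using coarsest by simp
  qed
qed

lemma minimal_R1_imp_filter_converges:
  assumes min: "minimal_R1_in \<tau> (L_family \<rho>)" and \<F>: "open_filter \<tau> \<F>"
    and x: "x \<in> topspace \<tau>" and adh: "adherence \<tau> \<F> = \<tau> closure_of {x}"
  shows "converges_to \<tau> \<F> x"
proof -
  let ?\<sigma> = "restrict_nbhds \<tau> x \<F>"
  have \<tau>: "\<tau> \<in> L_family \<rho>" and R1: "R1_space \<tau>"
    using min by (auto simp: minimal_R1_in_def)
  have \<sigma>: "?\<sigma> \<in> L_family \<rho>"
    using \<tau> R1_space_imp_R0_space[OF R1] \<F> adh by (rule restrict_nbhds_in_L_family)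
  have "?\<sigma> closure_of {y} = \<tau> closure_of {y}" if "y \<in> topspace \<tau>" for y
    using that L_family_point_closure[OF \<sigma>] L_family_point_closure[OF \<tau>] \<tau>
    by (simp add: L_family_def)
  then have "R1_space ?\<sigma>"
    using R1 \<F> x adh by (intro R1_space_restrict_nbhds)
  then have "?\<sigma> = \<tau>"
    using min \<sigma> restrict_nbhds_le[OF \<F>] unfolding minimal_R1_in_def by blast
  then have "U \<in> \<F>" if "openin \<tau> U" "x \<in> U" for U
    using openin_restrict_nbhds[OF \<F>, of x U] that by simp
  then show ?thesis
    by (auto simp: converges_to_def open_nbhds_def)
qed

theorem theorem3p8:
  fixes X :: "'a set" and \<rho> \<tau> :: "'a topology"
  assumes "topspace \<rho> = X"
    and "R0_space \<rho>"
    and "\<exists>\<C>. \<C> \<subseteq> {\<rho> closure_of {x} | x. x \<in> X} \<and> infinite \<C> \<and> pairwise disjnt \<C> \<and> \<Union>\<C> = X"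
    and "\<tau> \<in> L_family \<rho>"
    and "R1_space \<tau>"
  shows "(minimal_R1_in \<tau> (L_family \<rho>) \<longleftrightarrow>
           (\<forall>\<F>. open_filter \<tau> \<F> \<and> (\<exists>x\<in>X. adherence \<tau> \<F> = \<tau> closure_of {x}) \<longrightarrow>
                convergent_open_filter \<tau> \<F>)) \<and>
         (\<forall>\<F>. \<forall>x\<in>X. open_filter \<tau> \<F> \<and> adherence \<tau> \<F> = \<tau> closure_of {x} \<and>
                convergent_open_filter \<tau> \<F> \<longrightarrow>
              (\<forall>y \<in> \<tau> closure_of {x}. converges_to \<tau> \<F> y))"
proof (intro conjI iffI allI impI ballI)
  fix \<F> assume "minimal_R1_in \<tau> (L_family \<rho>)"
    and "open_filter \<tau> \<F> \<and> (\<exists>x\<in>X. adherence \<tau> \<F> = \<tau> closure_of {x})"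
  moreover have "topspace \<tau> = X"
    using assms(1,4) by (simp add: L_family_def)
  ultimately show "convergent_open_filter \<tau> \<F>"
    unfolding convergent_open_filter_def by (blast intro: minimal_R1_imp_filter_converges)
next
  assume conv: "\<forall>\<F>. open_filter \<tau> \<F> \<and> (\<exists>x\<in>X. adherence \<tau> \<F> = \<tau> closure_of {x}) \<longrightarrow>
                convergent_open_filter \<tau> \<F>"
  have "topspace \<tau> = X"
    using assms(1,4) by (simp add: L_family_def)
  then show "minimal_R1_in \<tau> (L_family \<rho>)"
    using conv by (intro filters_converge_imp_minimal_R1[OF assms(4,5)]) blast
next
  fix \<F> x y
  assume "open_filter \<tau> \<F> \<and> adherence \<tau> \<F> = \<tau> closure_of {x} \<and> convergent_open_filter \<tau> \<F>"
    and "y \<in> \<tau> closure_of {x}"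
  then show "converges_to \<tau> \<F> y"
    by (blast intro: convergent_imp_converges_to_point_closure R1_space_imp_R0_space assms(5))
qed

end
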